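(* Let $\Sigma_d$ be a discrete-time system $x[k+1]=f_d(x[k],u[k])$, $y[k]=h_d(x[k],u[k])$. If there exist $\lambda,a,b,c>0$, $d_1\ge0$ such that $\Sigma_d$ is 1) $0$-step strongly detectable with a function $p$ satisfying $p(x)\ge c|x|^\lambda$; 2) IF-OFQP$(\nu,\rho,\delta)$ with $\rho>0$, $\delta\ge0$ and a continuous storage function $V(x)$ that satisfies $a|x|^\lambda\le V(x)\le b|x|^\lambda+d_1$, then $\Sigma_d$ is input-to-state practically stable (ISpS).
   Context: $|\cdot|$ is the Euclidean norm and $\|u\|=\sup_{k\in\mathbb{Z}_{\ge0}}|u[k]|$. The maps $f_d,h_d$ are continuous, the state is in $\mathbb{R}^n$, and input and output have the same dimension $m$. $0$-step strongly detectable: there are $\vartheta\ge0$ and a radially unbounded, positive definite function $p:\mathbb{R}^n\to\mathbb{R}_{\ge0}$ such that $\vartheta|u[k_0]|^2+|y[k_0]|^2\ge p(x[k_0])$ for any $k_0\in\mathbb{Z}_{\ge0}$, any state $x[k_0]\in\mathbb{R}^n$ and any admissible input. IF-OFQP$(\nu,\rho,\delta)$ ($\nu,\rho\in\mathbb{R}$, $\delta\ge0$) with storage function $V$: for any $k_0<k_1$ in $\mathbb{Z}_{\ge0}$, any $x[k_0]$ and any admissible input, $V(x[k_1])-V(x[k_0])\le\sum_{i=k_0}^{k_1-1}\left(u[i]^\top y[i]-\nu|u[i]|^2-\rho|y[i]|^2+\delta\right)$. ISpS: there exist a $\mathcal{KL}$-function $\beta_1$, a $\mathcal K$-function $\beta_2$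 and a positive constant $d$ such that for any $u$ with $\|u\|<\infty$ and any initial state $x_0\in\mathbb{R}^n$, $|x[k]|\le\beta_1(|x_0|,k)+\beta_2(\max_{0\le j\le k-1}|u[j]|)+d$ for all $k\in\mathbb{Z}_{\ge0}$ (the maximum over an empty index set is $0$). Class $\mathcal K$: continuous, strictly increasing functions $\mathbb{R}_{\ge0}\to\mathbb{R}_{\ge0}$ vanishing at $0$; $\mathcal K_\infty$: those tending to $\infty$ at $\infty$; class $\mathcal{KL}$: continuous $f(r,s)$ that is $\mathcal K_\infty$ in $r$ for each fixed $s$, and decreasing in $s$ with $f(r,s)\to0$ as $s\to\infty$ for each fixed $r$. *)

theory Defs
  imports "HOL-Analysis.Analysis"
begin

text \<open>Comparison functions are total functions on the reals, of which only the values at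
  nonnegative arguments matter. The inclusion of the range in the nonnegative reals follows from
  monotonicity and the value at 0.\<close>

definition class_K :: "(real \<Rightarrow> real) \<Rightarrow> bool" where
  "class_K g \<longleftrightarrow> continuous_on {0..} g \<and> strict_mono_on {0..} g \<and> g 0 = 0"

definition class_K_inf :: "(real \<Rightarrow> real) \<Rightarrow> bool" where
  "class_K_inf g \<longleftrightarrow> class_K g \<and> filterlim g at_top at_top"

text \<open>Decreasing in \<open>s\<close> is meant in the weak sense; for \<open>r = 0\<close> the function is constantly 0.\<close>

definition class_KL :: "(real \<Rightarrow> real \<Rightarrow> real) \<Rightarrow> bool" where
  "class_KL g \<longleftrightarrow>
     continuous_on ({0..} \<times> {0..}) (\<lambda>(r, s). g r s) \<and>
     (\<forall>s\<ge>0. class_K_inf (\<lambda>r. g r s)) \<and>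
     (\<forall>r\<ge>0. antimono_on {0..} (g r) \<and> (g r \<longlongrightarrow> 0) at_top)"

text \<open>State trajectories started at time \<open>k0\<close> from an arbitrary state \<open>x k0\<close>; the values of \<open>x\<close>
  before \<open>k0\<close> are irrelevant. Every input sequence is admissible. The output at time \<open>k\<close>
  is \<open>h (x k) (u k)\<close>.\<close>

definition trajectory_from ::
  "(real^'n \<Rightarrow> real^'m \<Rightarrow> real^'n) \<Rightarrow> nat \<Rightarrow> (nat \<Rightarrow> real^'m) \<Rightarrow> (nat \<Rightarrow> real^'n) \<Rightarrow> bool" where
  "trajectory_from f k0 u x \<longleftrightarrow> (\<forall>k\<ge>k0. x (Suc k) = f (x k) (u k))"

definition positive_definite_fun :: "(real^'n \<Rightarrow> real) \<Rightarrow> bool" where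
  "positive_definite_fun p \<longleftrightarrow> p 0 = 0 \<and> (\<forall>x. x \<noteq> 0 \<longrightarrow> p x > 0)"

definition radially_unbounded :: "(real^'n \<Rightarrow> real) \<Rightarrow> bool" where
  "radially_unbounded p \<longleftrightarrow> filterlim p at_top at_infinity"

definition zero_step_strongly_detectable ::
  "(real^'n \<Rightarrow> real^'m \<Rightarrow> real^'n) \<Rightarrow> (real^'n \<Rightarrow> real^'m \<Rightarrow> real^'m) \<Rightarrow> (real^'n \<Rightarrow> real) \<Rightarrow> bool" where
  "zero_step_strongly_detectable f h p \<longleftrightarrow>
     radially_unbounded p \<and> positive_definite_fun p \<and>
     (\<exists>\<theta>\<ge>0. \<forall>k0 u x. trajectory_from f k0 u x \<longrightarrow>
        \<theta> * (norm (u k0))\<^sup>2 + (norm (h (x k0) (u k0)))\<^sup>2 \<ge> p (x k0))"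

definition IF_OFQP ::
  "(real^'n \<Rightarrow> real^'m \<Rightarrow> real^'n) \<Rightarrow> (real^'n \<Rightarrow> real^'m \<Rightarrow> real^'m) \<Rightarrow>
    real \<Rightarrow> real \<Rightarrow> real \<Rightarrow> (real^'n \<Rightarrow> real) \<Rightarrow> bool" where
  "IF_OFQP f h \<nu> \<rho> \<delta> V \<longleftrightarrow>
     (\<forall>k0 k1 u x. k0 < k1 \<longrightarrow> trajectory_from f k0 u x \<longrightarrow>
        V (x k1) - V (x k0) \<le>
          (\<Sum>i = k0..<k1. u i \<bullet> h (x i) (u i) - \<nu> * (norm (u i))\<^sup>2
             - \<rho> * (norm (h (x i) (u i)))\<^sup>2 + \<delta>))"

definition sup_norm :: "(nat \<Rightarrow> real^'m) \<Rightarrow> ereal" where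
  "sup_norm u = (SUP k. ereal (norm (u k)))"

definition max_norm_upto :: "(nat \<Rightarrow> real^'m) \<Rightarrow> nat \<Rightarrow> real" where
  "max_norm_upto u k = (if k = 0 then 0 else Max ((\<lambda>j. norm (u j)) ` {..<k}))"

definition ISpS :: "(real^'n \<Rightarrow> real^'m \<Rightarrow> real^'n) \<Rightarrow> bool" where
  "ISpS f \<longleftrightarrow>
     (\<exists>\<beta>1 \<beta>2 d. class_KL \<beta>1 \<and> class_K \<beta>2 \<and> d > 0 \<and>
        (\<forall>u x. sup_norm u < \<infinity> \<longrightarrow> trajectory_from f 0 u x \<longrightarrow>
           (\<forall>k. norm (x k) \<le> \<beta>1 (norm (x 0)) (real k) + \<beta>2 (max_norm_upto u k) + d)))"

end

theory Submission
  imports Defs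
begin

text \<open>
  The storage function itself is an ISpS Lyapunov function with exponential decay. Completing the
  square in the supply rate, \<open>u \<bullet> y \<le> |u|\<^sup>2 / (2\<rho>) + (\<rho>/2) |y|\<^sup>2\<close>, leaves the term
  \<open>- (\<rho>/2) |y|\<^sup>2\<close>, because \<open>\<rho> > 0\<close>. Detectability turns this dissipation in the output into
  dissipation in the state, \<open>- (\<rho>/2) c |x|\<^sup>l\<close>, up to a multiple of \<open>|u|\<^sup>2\<close>. Since
  the upper bound on \<open>V\<close> has the same exponent \<open>l\<close>, this is at least a fixed fraction of
  \<open>V\<close>, up to a constant; thus one step contracts \<open>V\<close> by a factor \<open>q < 1\<close>, up to an additive term
  \<open>C |u|\<^sup>2 + const\<close> (\<open>storage_contraction\<close>).

  Iterating this gives \<open>V (x k) \<le> q\<^sup>k V (x 0) + (C M\<^sup>2 + const) / (1 - q)\<close> with \<open>M\<close> the maximum of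
  the past input norms (\<open>affine_recursion_bound\<close>). Both sides are compared with \<open>|\<cdot>|\<^sup>l\<close>
  and a root of order \<open>l\<close> is taken, which splits over the three summands up to a
  factor (\<open>powr_add3_le\<close>). This matching of exponents makes the resulting
  \<open>\<beta>\<^sub>1\<close> linear in the initial state and exponential in time, and \<open>\<beta>\<^sub>2\<close> a power function.
\<close>

lemma class_K_powr:
  assumes "K > 0" "e > 0"
  shows "class_K (\<lambda>r. K * r powr e)"
  unfolding class_K_def
proof (intro conjI)
  show "continuous_on {0..} (\<lambda>r. K * r powr e)"
    using assms by (intro continuous_intros continuous_on_powr') auto
  show "strict_mono_on {0..} (\<lambda>r. K * r powr e)"
    using assms by (auto intro!: strict_mono_onI powr_less_mono2)
qed (use assms in auto)

lemma class_KL_linear_exponential: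
  assumes "K > 0" "0 < w" "w < 1"
  shows "class_KL (\<lambda>r t. K * w powr t * r)"
  unfolding class_KL_def
proof (intro conjI allI impI)
  show "continuous_on ({0..} \<times> {0..}) (\<lambda>(r, t). K * w powr t * r)"
    using assms by (auto simp: case_prod_unfold intro!: continuous_intros)
next
  fix t :: real
  have pos: "K * w powr t > 0" using assms by simp
  show "class_K_inf (\<lambda>r. K * w powr t * r)"
    unfolding class_K_inf_def class_K_def
  proof (intro conjI)
    show "strict_mono_on {0..} (\<lambda>r. K * w powr t * r)"
      using pos by (intro strict_mono_onI mult_strict_left_mono)
    show "filterlim (\<lambda>r. K * w powr t * r) at_top at_top"
      using pos by (intro filterlim_tendsto_pos_mult_at_top[OF tendsto_const] filterlim_ident)
  qed (auto intro!: continuous_intros)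
next
  fix r :: real
  assume "r \<ge> 0"
  then show "antimono_on {0..} (\<lambda>t. K * w powr t * r)"
    using assms by (auto intro!: monotone_onI mult_right_mono mult_left_mono powr_mono')
  have "((\<lambda>t. w powr t) \<longlongrightarrow> 0) at_top"
  proof -
    have "((\<lambda>t. exp (- (- ln w * t))) \<longlongrightarrow> 0) at_top"
      using assms
      by (intro filterlim_compose[OF exp_at_bot] filterlim_compose[OF filterlim_uminus_at_bot_at_top]
          filterlim_tendsto_pos_mult_at_top[OF tendsto_const] filterlim_ident) auto
    then show ?thesis using assms by (simp add: powr_def mult.commute)
  qed
  from tendsto_mult_right[OF tendsto_mult_left[OF this, of K], of r]
  show "((\<lambda>t. K * w powr t * r) \<longlongrightarrow> 0) at_top" by simp
qed

text \<open>A substitute for subadditivity that is valid for every positive exponent, also above 1: the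
  sum is at most three times its largest summand.\<close>

lemma powr_add3_le:
  fixes x y z s :: real
  assumes "x \<ge> 0" "y \<ge> 0" "z \<ge> 0" "s > 0"
  shows "(x + y + z) powr s \<le> (3 * x) powr s + (3 * y) powr s + (3 * z) powr s"
proof -
  define m where "m = max x (max y z)"
  have "(x + y + z) powr s \<le> (3 * m) powr s"
    using assms by (intro powr_mono2) (auto simp: m_def)
  also have "\<dots> \<le> (3 * x) powr s + (3 * y) powr s + (3 * z) powr s"
    by (auto simp: m_def max_def)
  finally show ?thesis .
qed

text \<open>The value \<open>e / (1 - q)\<close> is the fixed point of the recursion; deviations from it shrink
  by the factor \<open>q\<close> in each step.\<close>

lemma affine_recursion_bound:
  fixes v :: "nat \<Rightarrow> real"
  assumes "0 \<le> q" "q < 1" "0 \<le> e"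
    and step: "\<And>k. k < N \<Longrightarrow> v (Suc k) \<le> q * v k + e"
  shows "v N \<le> q ^ N * v 0 + e / (1 - q)"
  using step
proof (induction N)
  case 0
  then show ?case using assms by simp
next
  case (Suc N)
  have "v (Suc N) \<le> q * v N + e" using Suc.prems by simp
  also have "\<dots> \<le> q * (q ^ N * v 0 + e / (1 - q)) + e"
    using Suc assms by (intro add_right_mono mult_left_mono) auto
  also have "\<dots> = q ^ Suc N * v 0 + e / (1 - q)"
    using assms by (simp add: field_simps)
  finally show ?case .
qed

lemma norm_le_max_norm_upto:
  assumes "j < k"
  shows "norm (u j) \<le> max_norm_upto u k"
  using assms by (auto simp: max_norm_upto_def)

lemma max_norm_upto_nonneg: "0 \<le> max_norm_upto u k"
proof (cases k)
  case (Suc j)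
  then show ?thesis
    using norm_le_max_norm_upto[of 0 k u] norm_ge_zero[of "u 0"] by linarith
qed (simp add: max_norm_upto_def)

text \<open>The dissipation inequality, restricted to one step, as a contraction of the storage function.
  The constant \<open>\<kappa>\<close> is half of the state dissipation rate \<open>\<rho> c\<close> relative to the growth rate \<open>b\<close> of
  the storage function; it is cut off at \<open>1/2\<close> so that the factor \<open>1 - \<kappa>\<close> stays positive.\<close>

lemma storage_contraction:
  fixes f :: "real^'n \<Rightarrow> real^'m \<Rightarrow> real^'n" and h :: "real^'n \<Rightarrow> real^'m \<Rightarrow> real^'m"
  assumes pos: "b > 0" "c > 0" "\<rho> > 0"
    and detect: "zero_step_strongly_detectable f h p" "\<And>x. p x \<ge> c * norm x powr l"
    and dissip: "IF_OFQP f h \<nu> \<rho> \<delta> V"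
    and upper: "\<And>x. V x \<le> b * norm x powr l + d\<^sub>1"
  obtains \<kappa> C where "0 < \<kappa>" "\<kappa> < 1" "C > 0"
    "\<And>u x k. trajectory_from f 0 u x \<Longrightarrow>
       V (x (Suc k)) \<le> (1 - \<kappa>) * V (x k) + (\<kappa> * d\<^sub>1 + C * (norm (u k))\<^sup>2 + \<delta>)"
proof -
  from detect(1) obtain \<theta> where "\<theta> \<ge> 0" and \<theta>: "\<And>k u x. trajectory_from f k u x \<Longrightarrow>
      p (x k) \<le> \<theta> * (norm (u k))\<^sup>2 + (norm (h (x k) (u k)))\<^sup>2"
    unfolding zero_step_strongly_detectable_def by blast
  define \<kappa> where "\<kappa> = min (\<rho> * c / (2 * b)) (1/2)"
  define C where "C = 1 / (2 * \<rho>) + \<bar>\<nu>\<bar> + \<rho> / 2 * \<theta>"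
  have "0 < \<kappa>" "\<kappa> < 1" using pos by (auto simp: \<kappa>_def)
  have "C > 0" using pos \<open>\<theta> \<ge> 0\<close> by (auto simp: C_def intro!: add_pos_nonneg)
  have \<kappa>_le: "\<kappa> * b \<le> \<rho> / 2 * c"
  proof -
    have "\<kappa> * b \<le> \<rho> * c / (2 * b) * b"
      using pos by (intro mult_right_mono) (auto simp: \<kappa>_def)
    then show ?thesis using pos by simp
  qed
  have "V (x (Suc k)) \<le> (1 - \<kappa>) * V (x k) + (\<kappa> * d\<^sub>1 + C * (norm (u k))\<^sup>2 + \<delta>)"
    if traj: "trajectory_from f 0 u x" for u x k
  proof -
    define U where "U = norm (u k)"
    define Y where "Y = norm (h (x k) (u k))"
    define X where "X = norm (x k) powr l"
    have trajk: "trajectory_from f k u x"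
      using traj by (simp add: trajectory_from_def)
    have supply_rate: "V (x (Suc k)) - V (x k) \<le>
        u k \<bullet> h (x k) (u k) - \<nu> * U\<^sup>2 - \<rho> * Y\<^sup>2 + \<delta>"
      using dissip[unfolded IF_OFQP_def, rule_format, of k "Suc k" u x] trajk
      unfolding U_def Y_def by simp
    have "u k \<bullet> h (x k) (u k) \<le> U * Y"
      unfolding U_def Y_def by (rule norm_cauchy_schwarz)
    also have "U * Y \<le> 1 / (2 * \<rho>) * U\<^sup>2 + \<rho> / 2 * Y\<^sup>2"
    proof -
      have "0 \<le> (U - \<rho> * Y)\<^sup>2 / (2 * \<rho>)" using pos by simp
      also have "\<dots> = 1 / (2 * \<rho>) * U\<^sup>2 + \<rho> / 2 * Y\<^sup>2 - U * Y"
        using pos by (simp add: field_simps power2_eq_square)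
      finally show ?thesis by simp
    qed
    finally have young: "u k \<bullet> h (x k) (u k) \<le> 1 / (2 * \<rho>) * U\<^sup>2 + \<rho> / 2 * Y\<^sup>2" .
    have nu_le: "- \<nu> * U\<^sup>2 \<le> \<bar>\<nu>\<bar> * U\<^sup>2"
      by (intro mult_right_mono) auto
    have "c * X \<le> \<theta> * U\<^sup>2 + Y\<^sup>2"
      using \<theta>[OF trajk] detect(2)[of "x k"] unfolding U_def Y_def X_def by linarith
    then have "\<rho> / 2 * (c * X) \<le> \<rho> / 2 * (\<theta> * U\<^sup>2 + Y\<^sup>2)"
      using pos by (intro mult_left_mono) auto
    moreover have "\<kappa> * b * X \<le> \<rho> / 2 * c * X"
      using \<kappa>_le by (intro mult_right_mono) (auto simp: X_def)
    moreover have "\<kappa> * V (x k) \<le> \<kappa> * (b * X + d\<^sub>1)"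
      using upper[of "x k"] \<open>0 < \<kappa>\<close> unfolding X_def by (intro mult_left_mono) auto
    ultimately have state: "\<kappa> * V (x k) - \<kappa> * d\<^sub>1 \<le> \<rho> / 2 * \<theta> * U\<^sup>2 + \<rho> / 2 * Y\<^sup>2"
      by (simp add: algebra_simps)
    have "C * U\<^sup>2 = 1 / (2 * \<rho>) * U\<^sup>2 + \<bar>\<nu>\<bar> * U\<^sup>2 + \<rho> / 2 * \<theta> * U\<^sup>2"
      by (simp add: C_def distrib_right)
    then show ?thesis
      using supply_rate young nu_le state unfolding U_def[symmetric] by (simp add: algebra_simps)
  qed
  with \<open>0 < \<kappa>\<close> \<open>\<kappa> < 1\<close> \<open>C > 0\<close> show thesis by (rule that)
qed

theorem lemma5:
  fixes f\<^sub>d :: "real^'n \<Rightarrow> real^'m \<Rightarrow> real^'n"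
    and h\<^sub>d :: "real^'n \<Rightarrow> real^'m \<Rightarrow> real^'m"
    and p V :: "real^'n \<Rightarrow> real"
    and l a b c d\<^sub>1 \<nu> \<rho> \<delta> :: real
  assumes "continuous_on UNIV (\<lambda>(x, u). f\<^sub>d x u)"
    and "continuous_on UNIV (\<lambda>(x, u). h\<^sub>d x u)"
    and "l > 0" "a > 0" "b > 0" "c > 0" "d\<^sub>1 \<ge> 0"
    and "zero_step_strongly_detectable f\<^sub>d h\<^sub>d p"
    and "\<And>x. p x \<ge> c * norm x powr l"
    and "\<rho> > 0" "\<delta> \<ge> 0"
    and "IF_OFQP f\<^sub>d h\<^sub>d \<nu> \<rho> \<delta> V"
    and "continuous_on UNIV V"
    and "\<And>x. a * norm x powr l \<le> V x"
    and "\<And>x. V x \<le> b * norm x powr l + d\<^sub>1"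
  shows "ISpS f\<^sub>d"
proof -
  obtain \<kappa> C where \<kappa>: "0 < \<kappa>" "\<kappa> < 1" and "C > 0"
    and contraction: "\<And>u x k. trajectory_from f\<^sub>d 0 u x \<Longrightarrow>
       V (x (Suc k)) \<le> (1 - \<kappa>) * V (x k) + (\<kappa> * d\<^sub>1 + C * (norm (u k))\<^sup>2 + \<delta>)"
    using storage_contraction[OF assms(5,6,10,8,9,12,15)] by blast
  define s where "s = 1 / l"
  define K where "K = (3 * (b / a)) powr s"
  define w where "w = (1 - \<kappa>) powr s"
  define G where "G = (3 * (C / (a * \<kappa>))) powr s"
  define E where "E = (2 * d\<^sub>1 + \<delta> / \<kappa>) / a"
  have "s > 0" using \<open>l > 0\<close> by (simp add: s_def)
  have "K > 0" "G > 0" using \<open>a > 0\<close> \<open>b > 0\<close> \<open>C > 0\<close> \<kappa> by (auto simp: K_def G_def)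
  have w: "0 < w" "w < 1"
    using \<kappa> \<open>s > 0\<close> powr_less_mono2[of s "1 - \<kappa>" 1] by (auto simp: w_def)
  have "E \<ge> 0" using assms(4,7,11) \<kappa> by (simp add: E_def)
  have bound: "norm (x k) \<le> K * w powr real k * norm (x 0) + G * max_norm_upto u k powr (2 * s)
      + ((3 * E) powr s + 1)"
    if traj: "trajectory_from f\<^sub>d 0 u x" for u x k
  proof -
    define M where "M = max_norm_upto u k"
    define X where "X = norm (x 0) powr l"
    have "M \<ge> 0" by (simp add: M_def max_norm_upto_nonneg)
    have q: "0 \<le> (1 - \<kappa>) ^ k" "(1 - \<kappa>) ^ k \<le> 1"
      using \<kappa> by (auto intro: power_le_one)
    have "V (x (Suc j)) \<le> (1 - \<kappa>) * V (x j) + (\<kappa> * d\<^sub>1 + C * M\<^sup>2 + \<delta>)" if "j < k" for j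
    proof -
      have "C * (norm (u j))\<^sup>2 \<le> C * M\<^sup>2"
        using norm_le_max_norm_upto[OF that, of u] \<open>C > 0\<close>
        by (intro mult_left_mono power_mono) (auto simp: M_def)
      then show ?thesis using contraction[OF traj, of j] by linarith
    qed
    then have "V (x k) \<le> (1 - \<kappa>) ^ k * V (x 0) + (\<kappa> * d\<^sub>1 + C * M\<^sup>2 + \<delta>) / (1 - (1 - \<kappa>))"
      using \<kappa> \<open>C > 0\<close> assms(7,11) by (intro affine_recursion_bound) auto
    also have "\<dots> = (1 - \<kappa>) ^ k * V (x 0) + (d\<^sub>1 + C / \<kappa> * M\<^sup>2 + \<delta> / \<kappa>)"
      using \<kappa> by (simp add: field_simps)
    also have "(1 - \<kappa>) ^ k * V (x 0) \<le> (1 - \<kappa>) ^ k * (b * X + d\<^sub>1)"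
      using q assms(15)[of "x 0"] by (intro mult_left_mono) (auto simp: X_def)
    also have "\<dots> \<le> (1 - \<kappa>) ^ k * (b * X) + d\<^sub>1"
      using q assms(7) mult_right_mono[of "(1 - \<kappa>) ^ k" 1 d\<^sub>1] by (simp add: distrib_left)
    finally have "a * norm (x k) powr l \<le>
        (1 - \<kappa>) ^ k * (b * X) + d\<^sub>1 + (d\<^sub>1 + C / \<kappa> * M\<^sup>2 + \<delta> / \<kappa>)"
      using assms(14)[of "x k"] by linarith
    also have "\<dots> = a * (b / a * (1 - \<kappa>) ^ k * X + C / (a * \<kappa>) * M\<^sup>2 + E)"
      using \<open>a > 0\<close> \<kappa> by (simp add: E_def field_simps)
    finally have le: "norm (x k) powr l \<le> b / a * (1 - \<kappa>) ^ k * X + C / (a * \<kappa>) * M\<^sup>2 + E"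
      using \<open>a > 0\<close> by simp
    have "norm (x k) = (norm (x k) powr l) powr s"
      using \<open>l > 0\<close> by (simp add: powr_powr s_def)
    also have "\<dots> \<le> (b / a * (1 - \<kappa>) ^ k * X + C / (a * \<kappa>) * M\<^sup>2 + E) powr s"
      using le \<open>s > 0\<close> by (intro powr_mono2) auto
    also have "\<dots> \<le> (3 * (b / a * (1 - \<kappa>) ^ k * X)) powr s + (3 * (C / (a * \<kappa>) * M\<^sup>2)) powr s
        + (3 * E) powr s"
      using assms(4,5) \<open>C > 0\<close> \<kappa> \<open>E \<ge> 0\<close> \<open>s > 0\<close> by (intro powr_add3_le) (auto simp: X_def)
    also have "(3 * (b / a * (1 - \<kappa>) ^ k * X)) powr s = K * w powr real k * norm (x 0)"
    proof -
      have "X powr s = norm (x 0)"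
        using \<open>l > 0\<close> by (simp add: X_def powr_powr s_def)
      moreover have "((1 - \<kappa>) ^ k) powr s = w powr real k"
        using \<kappa> by (simp add: w_def powr_powr mult.commute flip: powr_realpow)
      moreover have "(3 * (b / a * (1 - \<kappa>) ^ k * X)) powr s
          = (3 * (b / a)) powr s * ((1 - \<kappa>) ^ k) powr s * X powr s"
        using assms(4,5) \<kappa> by (simp add: X_def mult.assoc flip: powr_mult)
      ultimately show ?thesis by (simp add: K_def)
    qed
    also have "(3 * (C / (a * \<kappa>) * M\<^sup>2)) powr s = G * M powr (2 * s)"
    proof -
      have "(M\<^sup>2) powr s = M powr (2 * s)"
        using \<open>M \<ge> 0\<close> by (cases "M = 0") (auto simp: powr_powr simp flip: powr_numeral)
      moreover have "(3 * (C / (a * \<kappa>) * M\<^sup>2)) powr s = G * (M\<^sup>2) powr s"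
        using assms(4) \<open>C > 0\<close> \<kappa> by (simp add: G_def mult.assoc flip: powr_mult)
      ultimately show ?thesis by simp
    qed
    finally show ?thesis by (simp add: M_def)
  qed
  show ?thesis
    unfolding ISpS_def
  proof (intro exI conjI allI impI)
    show "class_KL (\<lambda>r t. K * w powr t * r)"
      using \<open>K > 0\<close> w by (rule class_KL_linear_exponential)
    show "class_K (\<lambda>r. G * r powr (2 * s))"
      using \<open>G > 0\<close> \<open>s > 0\<close> by (intro class_K_powr) auto
    \<comment> \<open>The summand 1 makes the offset positive even if \<open>d\<^sub>1 = \<delta> = 0\<close>.\<close>
    show "(3 * E) powr s + 1 > 0"
      by (intro add_nonneg_pos) auto
  qed (rule bound)
qed

end
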